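(* Let $0<q<1$ and $\nu>-1$ be fixed, and let $j_{1\nu}<j_{2\nu}<\cdots$ be the positive zeros of $z\mapsto J_\nu(z;q^2)$. Then, for all sufficiently large positive integers $k$, $$\left|J_{\nu}(qj_{k\nu};q^2)\right|\leq\frac{(-q^2;q^2)_\infty\,(-q^{2(\nu+1)};q^2)_{\infty}}{(q^2;q^2)_{\infty}}\;q^{(k+\nu)(k-1)} .$$
   Context: For $0<p<1$: $(a;p)_0=1$, $(a;p)_n=\prod_{i=0}^{n-1}(1-ap^i)$, $(a;p)_\infty=\lim_{n\to\infty}(a;p)_n$. The third Jackson (Hahn--Exton) $q$-Bessel function, with base $q^2$, is defined for $z>0$ by $$J_{\nu}(z;q^2)=z^{\nu}\frac{(q^{2(\nu+1)};q^2)_\infty}{(q^2;q^2)_\infty}\sum_{k=0}^{\infty}(-1)^k\frac{q^{k(k+1)}}{(q^{2(\nu+1)};q^2)_k\,(q^2;q^2)_k}z^{2k}.$$ It is known that for $\nu>-1$ its positive zeros form a countably infinite set of simple zeros, which can be listed in increasing order $j_{1\nu}<j_{2\nu}<\cdots$. *)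

theory Defs
  imports Complex_Main
begin

definition qpoch :: "real \<Rightarrow> real \<Rightarrow> nat \<Rightarrow> real" where
  "qpoch a p n = (\<Prod>i<n. 1 - a * p ^ i)"

definition qpoch_inf :: "real \<Rightarrow> real \<Rightarrow> real" where
  "qpoch_inf a p = lim (\<lambda>n. qpoch a p n)"

text \<open>
  The third Jackson (Hahn--Exton) \<open>q\<close>-Bessel function \<open>J\<^sub>\<nu>(z; q\<^sup>2)\<close>, for \<open>0 < q < 1\<close> and \<open>z > 0\<close>.
  The first argument is \<open>q\<close>, while the base of the \<open>q\<close>-shifted factorials is \<open>q\<^sup>2\<close>.
\<close>
definition hahn_exton_J :: "real \<Rightarrow> real \<Rightarrow> real \<Rightarrow> real" where
  "hahn_exton_J q \<nu> z =
     z powr \<nu> * (qpoch_inf (q powr (2 * (\<nu> + 1))) (q\<^sup>2) / qpoch_inf (q\<^sup>2) (q\<^sup>2)) *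
     (\<Sum>k. (-1) ^ k * (q ^ (k * (k + 1)) /
            (qpoch (q powr (2 * (\<nu> + 1))) (q\<^sup>2) k * qpoch (q\<^sup>2) (q\<^sup>2) k)) * z ^ (2 * k))"

end

theory Submission
  imports Defs "HOL-Complex_Analysis.Complex_Analysis"
begin

text \<open>
  Write \<open>p = q\<^sup>2\<close>, \<open>w = q\<close> to the power \<open>2 (\<nu> + 1)\<close> and \<open>E x\<close> for the infinite product \<open>(x; p)\<close>
  with infinitely many factors. Then \<open>J\<^sub>\<nu>(z; q\<^sup>2)\<close> equals \<open>z powr \<nu> / E p\<close> times \<open>\<Phi> (p z\<^sup>2)\<close>, where \<open>\<Phi> x\<close> is the double
  series \<open>\<Sum>k m. e\<^sub>k e\<^sub>m p^(k m) x^k w^m\<close> with the Euler coefficients \<open>e\<^sub>m\<close> of \<open>E\<close>. Summed over \<open>k\<close> first,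
  it becomes \<open>\<Phi> x = \<Sum>m. e\<^sub>m w^m E (x p^m)\<close>, whose term with \<open>m = 0\<close> is \<open>E x\<close>, a function with
  the zeros \<open>1, 1/p, 1/p\<^sup>2, \<dots>\<close>. For large \<open>x\<close> away from these zeros, \<open>E (x p^m) = E x / (x; p)\<^sub>m\<close> is much
  smaller than \<open>E x\<close>, so \<open>\<Phi>\<close> is a small perturbation of \<open>E\<close>. This has two consequences.

  \<^item> On the circle of radius \<open>1 / (q p^n)\<close>, half way (on the logarithmic scale) between two zeros of \<open>E\<close>,
    Rouche's theorem applies for large \<open>n\<close>. So \<open>\<Phi>\<close> has at most \<open>n + 1\<close> zeros inside, and for large \<open>k\<close> the zero
    \<open>a\<^sub>k = p j\<^sub>k\<^sup>2\<close> of \<open>\<Phi>\<close> lies outside the circle with \<open>n = k - 2\<close> (lemma \<open>card_zeros_le\<close>).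
  \<^item> Let \<open>a = y / p^M\<close> be a zero of \<open>\<Phi>\<close> with \<open>q \<le> y \<le> 1/q\<close>. In both \<open>\<Phi> a = 0\<close> and \<open>\<Phi> (p a)\<close>, the terms with
    small \<open>m\<close> are multiples of \<open>E a\<close>. The first relation says that \<open>E a\<close> is as small as the remaining
    terms of \<open>\<Phi> a\<close>; hence \<open>y\<close> is close to \<open>1\<close>, and \<open>\<Phi> (p a)\<close> is dominated by its terms with
    \<open>m \<ge> M\<close>, which are of size \<open>w^M p^(M choose 2)\<close> (lemma \<open>qbessel_next_zero_eventually\<close>).

  By the first point \<open>M \<ge> k - 1\<close> for \<open>a = a\<^sub>k\<close>, and \<open>q j\<^sub>k\<close> corresponds to the argument \<open>p a\<^sub>k\<close>. The factor
  \<open>(q j\<^sub>k) powr \<nu>\<close> times \<open>w^M p^(M choose 2)\<close> is \<open>y powr (\<nu>/2) q powr (M (M + 1 + \<nu>))\<close>, which gives the claimed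
  power of \<open>q\<close>. The factor \<open>E (- w) > 1\<close> in the bound leaves the room that absorbs
  \<open>y powr (\<nu>/2)\<close> and the lower order terms.
\<close>

section \<open>Infinite products and the double series\<close>

locale euler_product =
  fixes p :: real
  assumes p_pos: "0 < p" and p_less_1: "p < 1"
begin

lemma p_power_le_1: "p ^ n \<le> 1"
  using p_pos p_less_1 by (simp add: power_le_one)

lemma qpoch_pos:
  assumes "a < 1"
  shows "0 < qpoch a p n"
  unfolding qpoch_def
proof (rule prod_pos)
  fix i
  have "a * p ^ i < 1"
  proof (cases "a \<le> 0")
    case True
    then have "a * p ^ i \<le> 0" using p_pos by (simp add: mult_nonpos_nonneg)
    then show ?thesis by simp
  next
    case False
    then have "a * p ^ i \<le> a" using p_power_le_1 by (simp add: mult_left_le)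
    then show ?thesis using assms by simp
  qed
  then show "0 < 1 - a * p ^ i" by simp
qed

definition coef :: "nat \<Rightarrow> real" where
  "coef m = (-1) ^ m * p ^ (m choose 2) / qpoch p p m"

text \<open>
  Euler's series for \<open>(x; p)\<close> with infinitely many factors. Taking the series instead of the product as definition
  makes holomorphy immediate. Real and complex arguments are both required: inequalities between
  products live over the reals, Rouche's theorem over the complex numbers.
\<close>

definition qprod :: "'a::{real_normed_field,banach} \<Rightarrow> 'a" where
  "qprod x = (\<Sum>m. of_real (coef m) * x ^ m)"

definition poch :: "'a::{real_normed_field,banach} \<Rightarrow> nat \<Rightarrow> 'a" where
  "poch x n = (\<Prod>i<n. 1 - x * of_real (p ^ i))"

text \<open>
  The \<open>q\<close>-Bessel function up to an elementary factor, in the variable \<open>x = p z\<^sup>2\<close>. The product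
  \<open>(w p^k; p)\<close> in the numerator is \<open>(w; p)\<close> divided by \<open>(w; p)\<^sub>k\<close>, which is how the denominators of the usual
  series disappear.
\<close>

definition qbessel :: "'a::{real_normed_field,banach} \<Rightarrow> 'a \<Rightarrow> 'a" where
  "qbessel w x = (\<Sum>k. of_real (coef k) * x ^ k * qprod (w * of_real (p ^ k)))"

lemma poch_real: "poch a n = qpoch a p n"
  by (simp add: poch_def qpoch_def)

lemma coef_0 [simp]: "coef 0 = 1"
  by (simp add: coef_def qpoch_def numeral_2_eq_2)

lemma abs_coef: "\<bar>coef m\<bar> = p ^ (m choose 2) / qpoch p p m"
  using qpoch_pos[OF p_less_1, of m] p_pos by (simp add: coef_def abs_mult power_abs)

lemma coef_Suc: "coef (Suc m) * (1 - p ^ Suc m) = - (p ^ m) * coef m"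
proof -
  have q: "qpoch p p (Suc m) = qpoch p p m * (1 - p ^ Suc m)"
    by (simp add: qpoch_def)
  have "qpoch p p (Suc m) \<noteq> 0" "qpoch p p m \<noteq> 0"
    using qpoch_pos[OF p_less_1] by (metis less_irrefl)+
  moreover have "p ^ (Suc m choose 2) = p ^ (m choose 2) * p ^ m"
    by (simp add: numeral_2_eq_2 power_add)
  ultimately show ?thesis
    unfolding coef_def by (simp add: q field_simps)
qed

text \<open>
  Successive coefficients have ratio \<open>- p^m / (1 - p^(m+1))\<close>, which tends to \<open>0\<close>.
\<close>

lemma summable_norm_coef:
  fixes x :: "'a::{real_normed_field,banach}"
  shows "summable (\<lambda>m. norm (of_real (coef m) * x ^ m))"
proof -
  have "(\<lambda>m. norm x / (1 - p) * p ^ m) \<longlonglongrightarrow> norm x / (1 - p) * 0"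
    using p_pos p_less_1 by (intro tendsto_intros LIMSEQ_power_zero) auto
  then have "\<forall>\<^sub>F m in sequentially. norm x / (1 - p) * p ^ m < 1/2"
    by (intro order_tendstoD(2)) auto
  then obtain N where N: "\<And>m. m \<ge> N \<Longrightarrow> norm x / (1 - p) * p ^ m < 1/2"
    by (auto simp: eventually_sequentially)
  show ?thesis
  proof (rule summable_ratio_test[of "1/2" N])
    fix m assume "m \<ge> N"
    have pm: "p ^ Suc m \<le> p" using p_pos p_less_1 p_power_le_1[of m] by (simp add: mult_left_le)
    then have pos: "1 - p ^ Suc m > 0" using p_less_1 by linarith
    have "\<bar>coef (Suc m)\<bar> * (1 - p ^ Suc m) = p ^ m * \<bar>coef m\<bar>"
      using arg_cong[OF coef_Suc[of m], of abs] pos p_pos by (simp add: abs_mult)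
    then have "\<bar>coef (Suc m)\<bar> = p ^ m * \<bar>coef m\<bar> / (1 - p ^ Suc m)"
      using pos by (simp add: field_simps)
    also have "\<dots> \<le> p ^ m * \<bar>coef m\<bar> / (1 - p)"
      using pm pos p_pos p_less_1 by (intro divide_left_mono) (auto intro!: mult_pos_pos)
    finally have "\<bar>coef (Suc m)\<bar> * norm x ^ Suc m \<le> p ^ m * \<bar>coef m\<bar> / (1 - p) * norm x ^ Suc m"
      by (intro mult_right_mono) auto
    also have "\<dots> = (norm x / (1 - p) * p ^ m) * (\<bar>coef m\<bar> * norm x ^ m)"
      by (simp add: field_simps)
    also have "\<dots> \<le> 1/2 * (\<bar>coef m\<bar> * norm x ^ m)"
      using N[OF \<open>m \<ge> N\<close>] by (intro mult_right_mono) auto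
    finally show "norm (norm (of_real (coef (Suc m)) * x ^ Suc m))
        \<le> 1/2 * norm (norm (of_real (coef m) * x ^ m))"
      by (simp add: norm_mult norm_power)
  qed simp
qed

lemmas summable_coef = summable_norm_cancel[OF summable_norm_coef]

lemma qprod_0 [simp]: "qprod 0 = 1"
  by (simp add: qprod_def)

lemma qprod_of_real: "qprod (of_real x :: 'a::{real_normed_field,banach}) = of_real (qprod x)"
proof -
  have "(\<lambda>m. of_real (coef m * x ^ m) :: 'a) sums of_real (qprod x)"
    unfolding qprod_def sums_of_real_iff using summable_coef[of x] by (simp add: summable_sums)
  then show ?thesis
    unfolding qprod_def by (simp add: sums_iff)
qed

lemma isCont_qprod: "isCont qprod (x :: 'a::{real_normed_field,banach})"
  unfolding qprod_def by (rule isCont_powser_converges_everywhere) (rule summable_coef)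

text \<open>
  The recursion \<open>coef_Suc\<close> of the coefficients, read as a functional equation. Iterating it and using continuity
  at \<open>0\<close> identifies the series with the infinite product.
\<close>

lemma qprod_rec: "qprod x = (1 - x) * qprod (x * of_real p)"
proof -
  let ?c = "\<lambda>m. of_real (coef m) :: 'a"
  let ?y = "x * of_real p"
  have s: "(\<lambda>m. ?c m * ?y ^ m) sums qprod ?y"
    unfolding qprod_def by (intro summable_sums summable_coef)
  have "(\<lambda>m. ?c (Suc m) * ?y ^ Suc m) sums (qprod ?y - 1)"
    using sums_split_initial_segment[OF s, of 1] by simp
  from sums_diff[OF this sums_mult[OF s, of x]]
  have "(\<lambda>m. ?c (Suc m) * ?y ^ Suc m - x * (?c m * ?y ^ m)) sums (qprod ?y - 1 - x * qprod ?y)" .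
  moreover have "?c (Suc m) * ?y ^ Suc m - x * (?c m * ?y ^ m) = ?c (Suc m) * x ^ Suc m" for m
  proof -
    have "?c (Suc m) * ?y ^ Suc m - x * (?c m * ?y ^ m)
      = of_real (coef (Suc m) * p ^ Suc m - p ^ m * coef m) * x ^ Suc m"
      by (simp add: power_mult_distrib algebra_simps)
    also have "coef (Suc m) * p ^ Suc m - p ^ m * coef m = coef (Suc m)"
      using coef_Suc[of m] by (simp add: algebra_simps)
    finally show ?thesis .
  qed
  ultimately have "(\<lambda>m. ?c (Suc m) * x ^ Suc m) sums (qprod ?y - 1 - x * qprod ?y)" by simp
  moreover have "(\<lambda>m. ?c (Suc m) * x ^ Suc m) sums (qprod x - 1)"
    using sums_split_initial_segment[OF summable_sums[OF summable_coef[of x]], of 1]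
    by (simp add: qprod_def)
  ultimately have "qprod x - 1 = qprod ?y - 1 - x * qprod ?y" by (rule sums_unique2[rotated])
  then show ?thesis by (simp add: algebra_simps)
qed

lemma qprod_split: "qprod x = poch x n * qprod (x * of_real (p ^ n))"
proof (induction n)
  case (Suc n)
  then show ?case
    using qprod_rec[of "x * of_real (p ^ n)"] by (simp add: poch_def mult_ac)
qed (simp add: poch_def)

lemma poch_add: "poch x (m + n) = poch x m * poch (x * of_real (p ^ m)) n"
  by (induction n) (simp_all add: poch_def power_add mult_ac)

lemma qprod_shift_tendsto_1: "(\<lambda>n. qprod (x * of_real (p ^ n))) \<longlonglongrightarrow> 1"
proof -
  have "(\<lambda>n. x * of_real p ^ n) \<longlonglongrightarrow> x * 0"
    using p_pos p_less_1 by (intro tendsto_intros LIMSEQ_power_zero) auto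
  then show ?thesis
    using isCont_tendsto_compose[OF isCont_qprod[of 0], of "\<lambda>n. x * of_real p ^ n"]
    by simp
qed

lemma poch_tendsto: "poch x \<longlonglongrightarrow> qprod x"
proof -
  have lim: "(\<lambda>n. qprod x / qprod (x * of_real (p ^ n))) \<longlonglongrightarrow> qprod x / 1"
    by (intro tendsto_intros qprod_shift_tendsto_1) auto
  have "\<forall>\<^sub>F n in sequentially. qprod (x * of_real (p ^ n)) \<noteq> 0"
    using qprod_shift_tendsto_1[of x] by (rule tendsto_imp_eventually_ne) auto
  then have "\<forall>\<^sub>F n in sequentially. qprod x / qprod (x * of_real (p ^ n)) = poch x n"
  proof eventually_elim
    case (elim n)
    then show ?case using qprod_split[of x n] by (simp add: field_simps)
  qed
  from Lim_transform_eventually[OF lim this] show ?thesis by simp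
qed

lemma qpoch_tendsto: "qpoch a p \<longlonglongrightarrow> qprod a"
  using poch_tendsto[of a] unfolding poch_real[abs_def] .

lemma qpoch_inf_eq_qprod: "qpoch_inf a p = qprod a"
  using limI[OF qpoch_tendsto] by (simp add: qpoch_inf_def)

lemma qprod_le_qpoch:
  fixes a :: real
  assumes "0 \<le> a" "a < 1"
  shows "qprod a \<le> qpoch a p n"
proof -
  have "qpoch a p m \<le> qpoch a p n" if "n \<le> m" for m
    using that
  proof (induction m rule: dec_induct)
    case (step m)
    have "qpoch a p m * (1 - a * p ^ m) \<le> qpoch a p m * 1"
      using qpoch_pos[OF assms(2), of m] assms p_pos by (intro mult_left_mono) auto
    then show ?case using step by (simp add: qpoch_def)
  qed simp
  then show ?thesis
    using qpoch_tendsto[of a] by (intro LIMSEQ_le_const2[of "qpoch a p"]) auto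
qed

lemma qprod_pos:
  fixes a :: real
  assumes "a < 1"
  shows "0 < qprod a"
proof -
  have "\<forall>\<^sub>F n in sequentially. 0 < qprod (a * of_real (p ^ n))"
    using qprod_shift_tendsto_1[of a] by (rule order_tendstoD(1)) auto
  then obtain n where "0 < qprod (a * of_real (p ^ n))"
    by (auto simp: eventually_sequentially)
  then show ?thesis
    using qprod_split[of a n] qpoch_pos[OF assms, of n] by (simp add: poch_real)
qed

lemma qprod_antimono:
  fixes a b :: real
  assumes "a \<le> b" "b < 1"
  shows "qprod b \<le> qprod a"
proof (rule LIMSEQ_le[OF poch_tendsto poch_tendsto])
  have "poch b n \<le> poch a n" for n
    unfolding poch_def
  proof (intro prod_mono conjI)
    fix i
    show "0 \<le> 1 - b * of_real (p ^ i)"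
      using qpoch_pos[OF assms(2), of 1] p_power_le_1[of i] p_pos assms
      by (cases "b \<le> 0") (auto simp: mult_nonpos_nonneg intro: order.trans[OF _ zero_le_one] mult_le_one)
    show "1 - b * of_real (p ^ i) \<le> 1 - a * of_real (p ^ i)"
      using assms p_pos by (simp add: mult_right_mono)
  qed
  then show "\<exists>N. \<forall>n\<ge>N. poch b n \<le> poch a n" by blast
qed

text \<open>
  The coefficients alternate in sign, so a negative argument produces the series of absolute values. This is
  the form in which \<open>(- w; p)\<close> enters all estimates below.
\<close>

lemma qprod_neg_eq: "qprod (- w) = (\<Sum>m. \<bar>coef m\<bar> * w ^ m)"
  unfolding qprod_def
proof (rule suminf_cong)
  fix m
  have "coef m * (-1) ^ m = \<bar>coef m\<bar>"
    by (simp add: abs_coef) (simp add: coef_def flip: power_mult_distrib)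
  then show "of_real (coef m) * (- w) ^ m = \<bar>coef m\<bar> * w ^ m"
    by (simp add: power_minus[of w] mult.assoc)
qed

lemma summable_abs_coef: "summable (\<lambda>m. \<bar>coef m\<bar> * w ^ m)" for w :: real
  using summable_norm_coef[of w]
  by (rule summable_rabs_cancel[OF summable_comparison_test'[of _ 0]]) (simp add: abs_mult)

text \<open>
  Expanding the inner product turns \<open>qbessel w x\<close> into the absolutely convergent double series with terms
  \<open>e\<^sub>k e\<^sub>m p^(k m) x^k w^m\<close>, which is symmetric in \<open>x\<close> and \<open>w\<close>. Holomorphy in \<open>x\<close> is visible on one side of the
  identity, closeness to \<open>qprod x\<close> on the other.
\<close>

lemma qbessel_commute: "qbessel w x = qbessel x (w :: 'a::{real_normed_field,banach})"
proof -
  let ?c = "\<lambda>m. of_real (coef m) :: 'a"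
  define F where "F = (\<lambda>k m. (?c k * x ^ k) * (?c m * w ^ m * of_real (p ^ (k * m))))"
  let ?A = "\<lambda>k. norm (?c k * x ^ k)" and ?B = "\<lambda>m. norm (?c m * w ^ m)"
  have SA: "?A summable_on UNIV" and SB: "?B summable_on UNIV"
    using norm_summable_imp_summable_on[of "\<lambda>m. norm (?c m * y ^ m)" for y] summable_norm_coef
    by auto
  have le: "norm (F k m) \<le> ?A k * ?B m" for k m
  proof -
    have "norm (F k m) = ?A k * ?B m * p ^ (k * m)"
      using p_pos by (simp add: F_def norm_mult norm_power)
    also have "\<dots> \<le> ?A k * ?B m"
      using p_power_le_1 by (intro mult_left_le) auto
    finally show ?thesis .
  qed
  have "(\<lambda>z. norm (case z of (k, m) \<Rightarrow> ?A k * ?B m)) summable_on UNIV \<times> UNIV"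
    unfolding Infinite_Sum.abs_summable_on_Sigma_iff
  proof (intro conjI ballI)
    show "(\<lambda>m. norm (case (k, m) of (k, m) \<Rightarrow> ?A k * ?B m)) summable_on UNIV" for k
      using summable_on_cmult_right[OF SB, of "?A k"] by (simp add: abs_mult)
    have "(\<Sum>\<^sub>\<infinity>m. norm (case (k, m) of (k, m) \<Rightarrow> ?A k * ?B m)) = ?A k * infsum ?B UNIV" for k
      using infsum_cmult_right[OF SB, of "?A k"] by (simp add: abs_mult)
    moreover have "0 \<le> infsum ?B UNIV" by (rule infsum_nonneg) auto
    ultimately show "(\<lambda>k. norm (\<Sum>\<^sub>\<infinity>m. norm (case (k, m) of (k, m) \<Rightarrow> ?A k * ?B m))) summable_on UNIV"
      using summable_on_cmult_left[OF SA, of "infsum ?B UNIV"] by (simp add: abs_mult)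
  qed
  then have "(\<lambda>z. norm (case z of (k, m) \<Rightarrow> F k m)) summable_on UNIV \<times> UNIV"
  proof (rule Infinite_Sum.abs_summable_on_comparison_test)
    fix z :: "nat \<times> nat"
    show "norm (case z of (k, m) \<Rightarrow> F k m) \<le> norm (case z of (k, m) \<Rightarrow> ?A k * ?B m)"
      using le[of "fst z" "snd z"] by (simp add: case_prod_beta abs_mult)
  qed
  then have SF: "(\<lambda>(k, m). F k m) summable_on UNIV \<times> UNIV"
    by (rule abs_summable_summable)
  have abs_sum: "(\<lambda>m. ?c m * y ^ m) summable_on UNIV" "infsum (\<lambda>m. ?c m * y ^ m) UNIV = qprod y" for y
    using norm_summable_imp_has_sum[OF summable_norm_coef[of y] summable_sums[OF summable_coef[of y]]]
    by (auto simp: qprod_def infsumI summable_on_def)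
  have suminf_eq: "suminf g = infsum g UNIV" if "g summable_on UNIV" for g :: "nat \<Rightarrow> 'a"
    using sums_unique[OF has_sum_imp_sums[OF has_sum_infsum[OF that]]] by simp
  have inner1: "infsum (F k) UNIV = ?c k * x ^ k * qprod (w * of_real (p ^ k))" for k
  proof -
    have "F k = (\<lambda>m. ?c k * x ^ k * (?c m * (w * of_real (p ^ k)) ^ m))"
      by (rule ext) (simp add: F_def power_mult_distrib power_mult mult_ac)
    then show ?thesis by (simp add: infsum_cmult_right abs_sum)
  qed
  have inner2: "infsum (\<lambda>k. F k m) UNIV = ?c m * w ^ m * qprod (x * of_real (p ^ m))" for m
  proof -
    have "(\<lambda>k. F k m) = (\<lambda>k. ?c m * w ^ m * (?c k * (x * of_real (p ^ m)) ^ k))"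
      by (rule ext) (simp add: F_def power_mult_distrib mult_ac flip: power_mult)
    then show ?thesis by (simp add: infsum_cmult_right abs_sum)
  qed
  have "(\<lambda>k. infsum (F k) UNIV) summable_on UNIV"
    using summable_on_Sigma_banach[OF SF] by simp
  then have "qbessel w x = infsum (\<lambda>k. infsum (F k) UNIV) UNIV"
    unfolding inner1 qbessel_def by (rule suminf_eq)
  also have "\<dots> = infsum (\<lambda>m. infsum (\<lambda>k. F k m) UNIV) UNIV"
    using SF by (rule infsum_swap_banach)
  also have "\<dots> = qbessel x w"
  proof -
    have "(\<lambda>(m, k). F k m) summable_on UNIV \<times> UNIV"
      using SF by (subst summable_on_swap) (simp add: case_prod_unfold)
    then have "(\<lambda>m. infsum (\<lambda>k. F k m) UNIV) summable_on UNIV"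
      using summable_on_Sigma_banach[of "\<lambda>m k. F k m" UNIV "\<lambda>_. UNIV"] by simp
    then show ?thesis
      unfolding inner2 qbessel_def by (rule suminf_eq[symmetric])
  qed
  finally show ?thesis .
qed

lemma poch_tendsto_norm: "(\<lambda>n. norm (poch x n)) \<longlonglongrightarrow> norm (qprod x)"
  by (intro tendsto_norm poch_tendsto)

lemma summable_norm_qbessel:
  fixes w x :: "'a::{real_normed_field,banach}"
  shows "summable (\<lambda>m. norm (of_real (coef m) * x ^ m * qprod (w * of_real (p ^ m))))"
proof -
  have "Bseq (\<lambda>m. qprod (w * of_real (p ^ m)))"
    using qprod_shift_tendsto_1 by (intro convergent_imp_Bseq) (auto simp: convergent_def)
  then obtain B where B: "\<And>m. norm (qprod (w * of_real (p ^ m))) \<le> B"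
    by (metis BseqE)
  show ?thesis
  proof (rule summable_comparison_test')
    show "summable (\<lambda>m. norm (of_real (coef m) * x ^ m) * B)"
      by (intro summable_mult2 summable_norm_coef)
    show "norm (norm (of_real (coef m) * x ^ m * qprod (w * of_real (p ^ m))))
        \<le> norm (of_real (coef m) * x ^ m) * B" for m
      using B[of m] by (simp add: norm_mult mult_left_mono)
  qed
qed

lemmas summable_qbessel = summable_norm_cancel[OF summable_norm_qbessel]

lemma qbessel_of_real: "qbessel (of_real w :: 'a::{real_normed_field,banach}) (of_real x) = of_real (qbessel w x)"
proof -
  have "(\<lambda>k. of_real (coef k * x ^ k * qprod (w * p ^ k)) :: 'a) sums of_real (qbessel w x)"
    unfolding qbessel_def sums_of_real_iff using summable_qbessel[of x w] by (simp add: summable_sums)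
  moreover have "of_real (coef k * x ^ k * qprod (w * p ^ k)) =
      of_real (coef k) * of_real x ^ k * qprod (of_real w * of_real (p ^ k) :: 'a)" for k
    using qprod_of_real[of "w * p ^ k", where 'a = 'a] by simp
  ultimately show ?thesis
    unfolding qbessel_def by (simp only: sums_iff)
qed

lemma qbessel_0: "qbessel w 0 = qprod w"
  unfolding qbessel_def using powser_zero[of "\<lambda>k. of_real (coef k) * qprod (w * of_real (p ^ k))"]
  by (simp add: mult_ac)

lemma qprod_holomorphic: "qprod holomorphic_on A"
  unfolding qprod_def[abs_def]
proof (rule holomorphic_on_subset[OF _ subset_UNIV])
  show "(\<lambda>x. \<Sum>m. of_real (coef m) * x ^ m) holomorphic_on (UNIV :: complex set)"
    unfolding holomorphic_on_def
    using termdiffs_strong_converges_everywhere[of "\<lambda>m. of_real (coef m) :: complex", OF summable_coef]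
    by (meson field_differentiable_def has_field_derivative_at_within)
qed

lemma qbessel_holomorphic: "qbessel w holomorphic_on (A :: complex set)"
proof (rule holomorphic_on_subset[OF _ subset_UNIV])
  let ?c = "\<lambda>k. of_real (coef k) * qprod (w * of_real (p ^ k)) :: complex"
  have eq: "qbessel w = (\<lambda>x. \<Sum>k. ?c k * x ^ k)"
    by (rule ext) (simp add: qbessel_def mult_ac)
  have "summable (\<lambda>k. ?c k * x ^ k)" for x
    using summable_qbessel[of x w] by (simp add: mult_ac)
  then show "qbessel w holomorphic_on UNIV"
    unfolding holomorphic_on_def eq using termdiffs_strong_converges_everywhere[of ?c]
    by (meson field_differentiable_def has_field_derivative_at_within)
qed

section \<open>Zeros of the infinite product\<close>

lemma qprod_nonzero_unit_disc:
  fixes u :: complex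
  assumes "norm u < 1"
  shows "qprod u \<noteq> 0"
proof -
  have "qpoch (norm u) p n \<le> norm (poch u n)" for n
    unfolding poch_def qpoch_def prod_norm[symmetric]
  proof (intro prod_mono conjI)
    fix i
    have "norm (u * of_real (p ^ i)) = norm u * p ^ i"
      using p_pos by (simp add: norm_mult norm_power)
    then show "1 - norm u * p ^ i \<le> norm (1 - u * of_real (p ^ i))"
      using norm_triangle_ineq2[of 1 "u * of_real (p ^ i)"] by simp
    show "0 \<le> 1 - norm u * p ^ i"
      using assms p_pos p_power_le_1[of i] by (simp add: mult_le_one)
  qed
  then have "qprod (norm u) \<le> norm (qprod u)"
    by (intro LIMSEQ_le[OF qpoch_tendsto poch_tendsto_norm]) auto
  then show ?thesis using qprod_pos[OF assms] by auto
qed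

lemma qprod_zero_iff:
  fixes z :: complex
  assumes "norm z * p ^ n < 1"
  shows "qprod z = 0 \<longleftrightarrow> (\<exists>i<n. z = of_real (1 / p ^ i))"
proof -
  have "norm (z * of_real (p ^ n)) < 1"
    using assms p_pos by (simp add: norm_mult norm_power)
  then have "qprod z = 0 \<longleftrightarrow> poch z n = 0"
    using qprod_split[of z n] qprod_nonzero_unit_disc by simp
  also have "\<dots> \<longleftrightarrow> (\<exists>i<n. z = of_real (1 / p ^ i))"
    using p_pos by (auto simp: poch_def field_simps)
  finally show ?thesis .
qed

text \<open>
  Splitting off the first \<open>n\<close> factors leaves a function without zeros in the disc of radius \<open>1 / p^n\<close>, and the
  linear factors have distinct zeros.
\<close>

lemma zorder_qprod:
  assumes "i < n"
  shows "zorder qprod (of_real (1 / p ^ i) :: complex) = 1"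
proof -
  let ?a = "of_real (1 / p ^ i) :: complex"
  define g where "g = (\<lambda>z::complex. - of_real (p ^ i) *
     (\<Prod>l\<in>{..<n} - {i}. 1 - z * of_real (p ^ l)) * qprod (z * of_real (p ^ n)))"
  show ?thesis
  proof (rule zorder_eqI)
    show "open (UNIV :: complex set)" "?a \<in> UNIV" by auto
    have "(qprod \<circ> (\<lambda>z. z * of_real (p ^ n))) holomorphic_on (UNIV :: complex set)"
      by (rule holomorphic_on_compose) (auto intro!: holomorphic_intros qprod_holomorphic)
    then show "g holomorphic_on UNIV"
      unfolding g_def by (intro holomorphic_intros) (simp_all add: o_def)
    have "norm (?a * of_real (p ^ n)) = p ^ n / p ^ i"
      using p_pos by (simp add: norm_mult norm_divide norm_power)
    also have "\<dots> < 1"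
      using assms p_pos p_less_1 by (simp add: power_strict_decreasing)
    finally have "qprod (?a * of_real (p ^ n)) \<noteq> 0" by (rule qprod_nonzero_unit_disc)
    moreover have "1 - ?a * of_real (p ^ l) \<noteq> 0" if "l \<noteq> i" for l
    proof
      assume "1 - ?a * of_real (p ^ l) = 0"
      then have "of_real (p ^ l) = (of_real (p ^ i) :: complex)"
        using p_pos by (simp add: field_simps)
      then have "p ^ l = p ^ i" using of_real_eq_iff by blast
      then show False
        using p_pos p_less_1 that by (simp add: power_inject_exp')
    qed
    ultimately show "g ?a \<noteq> 0"
      using p_pos by (auto simp: g_def)
    fix z :: complex
    have "poch z n = (1 - z * of_real (p ^ i)) * (\<Prod>l\<in>{..<n} - {i}. 1 - z * of_real (p ^ l))"
      unfolding poch_def using assms by (subst prod.remove[of _ i]) auto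
    moreover have "1 - z * of_real (p ^ i) = - of_real (p ^ i) * (z - ?a)"
      using p_pos by (simp add: field_simps)
    ultimately show "qprod z = g z * (z - ?a) powi 1"
      using qprod_split[of z n] by (simp add: g_def)
  qed
qed

end

text \<open>
  The parameter \<open>w\<close> stands for \<open>q powr (2 * (\<nu> + 1))\<close>; \<open>\<nu> > -1\<close> amounts to \<open>w < 1\<close>. The square root \<open>q\<close> of the base \<open>p\<close>
  is, on the logarithmic scale, half a step between consecutive zeros of \<open>qprod\<close>.
\<close>

locale hahn_exton = euler_product +
  fixes q w :: real
  assumes q_pos: "0 < q" and p_eq: "p = q\<^sup>2" and w_pos: "0 < w" and w_less_1: "w < 1"
begin

lemma q_less_1: "q < 1"
  using p_less_1 q_pos unfolding p_eq by (simp add: power_less_one_iff)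

lemma p_less_q: "p < q"
  using q_pos q_less_1 by (simp add: p_eq power2_eq_square)

lemma qprod_q: "0 < qprod q" "qprod q \<le> 1"
  using qprod_pos[OF q_less_1] qprod_antimono[of 0 q] q_less_1 q_pos by auto

section \<open>Lower bounds for finite products\<close>

lemma norm_poch_ge_inside:
  fixes u :: "'a::{real_normed_field,banach}"
  assumes "norm u \<le> q"
  shows "qprod q \<le> norm (poch u n)"
proof -
  have "qprod q \<le> qpoch q p n"
    using q_pos q_less_1 by (intro qprod_le_qpoch) auto
  also have "\<dots> \<le> norm (poch u n)"
    unfolding poch_def qpoch_def prod_norm[symmetric]
  proof (intro prod_mono conjI)
    fix i
    have "norm (u * of_real (p ^ i)) = norm u * p ^ i"
      using p_pos by (simp add: norm_mult norm_power)
    also have "\<dots> \<le> q * p ^ i"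
      using assms p_pos by (intro mult_right_mono) auto
    finally show "1 - q * p ^ i \<le> norm (1 - u * of_real (p ^ i))"
      using norm_triangle_ineq2[of 1 "u * of_real (p ^ i)"] by simp
    show "0 \<le> 1 - q * p ^ i"
      using q_pos q_less_1 p_pos p_power_le_1[of i] by (simp add: mult_le_one)
  qed
  finally show ?thesis .
qed

text \<open>
  If \<open>\<bar>x\<bar> \<ge> 1 / (q p^n)\<close>, each of the first \<open>n + 1\<close> factors \<open>1 - x p^i\<close> has absolute value at least \<open>(1 - t) / t\<close> with
  \<open>t = q p^(n - i) < 1\<close>. For \<open>i = 0\<close> the quotient \<open>1 / t\<close> is the gain \<open>1 / (q p^n)\<close>, for the other \<open>i\<close> it is
  at least \<open>1\<close>, and the numerators multiply to a part of the product for \<open>(q; p)\<close>.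
\<close>

lemma norm_poch_ge_outside:
  fixes x :: "'a::{real_normed_field,banach}"
  assumes x: "1 \<le> norm x * (q * p ^ n)" and m: "1 \<le> m" "m \<le> Suc n"
  shows "qprod q \<le> norm (poch x m) * (q * p ^ n)"
proof -
  define t where "t = (\<lambda>i. q * p ^ (n - i))"
  have t: "0 < t i" "t i < 1" for i
    using q_pos p_pos le_less_trans[OF mult_left_le[OF p_power_le_1[of "n - i"]] q_less_1]
    by (auto simp: t_def)
  have factor: "1 - t i \<le> norm (1 - x * of_real (p ^ i)) * t i" if "i \<le> n" for i
  proof -
    have "1 \<le> norm x * p ^ i * t i"
      using x that by (simp add: t_def mult_ac flip: power_add)
    then have "1 - t i \<le> (norm x * p ^ i - 1) * t i"
      by (simp add: algebra_simps)
    also have "norm x * p ^ i - 1 \<le> norm (1 - x * of_real (p ^ i))"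
      using norm_triangle_ineq2[of "x * of_real (p ^ i)" 1] p_pos
      by (simp add: norm_minus_commute norm_mult norm_power)
    finally show ?thesis using t[of i] by (simp add: mult_right_mono)
  qed
  have "qprod q \<le> qpoch q p (Suc n)"
    using q_pos q_less_1 by (intro qprod_le_qpoch) auto
  also have "\<dots> = (\<Prod>i<Suc n. 1 - t i)"
    unfolding qpoch_def t_def by (subst prod.nat_diff_reindex[symmetric]) simp
  also have "\<dots> \<le> (\<Prod>i<m. 1 - t i)"
  proof -
    have "(\<Prod>i<Suc n. 1 - t i) = (\<Prod>i<m. 1 - t i) * (\<Prod>i\<in>{..<Suc n} - {..<m}. 1 - t i)"
      using m by (subst prod.subset_diff[of "{..<m}"]) auto
    also have "\<dots> \<le> (\<Prod>i<m. 1 - t i)"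
      using t by (intro mult_left_le prod_le_1 prod_nonneg) (auto simp: less_imp_le)
    finally show ?thesis .
  qed
  also have "\<dots> \<le> (\<Prod>i<m. norm (1 - x * of_real (p ^ i)) * (if i = 0 then t 0 else 1))"
  proof (intro prod_mono conjI)
    fix i assume "i \<in> {..<m}"
    then have "1 - t i \<le> norm (1 - x * of_real (p ^ i)) * t i"
      using m by (intro factor) auto
    also have "\<dots> \<le> norm (1 - x * of_real (p ^ i)) * (if i = 0 then t 0 else 1)"
      using t[of i] by (intro mult_left_mono) auto
    finally show "1 - t i \<le> norm (1 - x * of_real (p ^ i)) * (if i = 0 then t 0 else 1)" .
  qed (use t in \<open>auto simp: less_imp_le\<close>)
  also have "\<dots> = norm (poch x m) * t 0"
    using m by (simp add: prod.distrib poch_def prod_norm[symmetric] prod.delta)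
  finally show ?thesis by (simp add: t_def)
qed

text \<open>
  Beyond the first \<open>n + 1\<close> factors the arguments \<open>x p^i\<close> of the remaining ones have absolute value at most \<open>q\<close>, so
  these factors contribute another \<open>(q; p)\<close>.
\<close>

lemma norm_poch_ge_circle:
  fixes x :: "'a::{real_normed_field,banach}"
  assumes x: "norm x * (q * p ^ n) = 1" and m: "1 \<le> m"
  shows "(qprod q)\<^sup>2 \<le> norm (poch x m) * (q * p ^ n)"
proof (cases "m \<le> Suc n")
  case True
  have "(qprod q)\<^sup>2 \<le> qprod q"
    using qprod_q by (simp add: power2_eq_square mult_left_le)
  then show ?thesis
    using norm_poch_ge_outside[of x n m] True assms by simp
next
  case False
  then obtain l where l: "m = Suc n + l" by (metis add.commute le_iff_add nat_le_linear)
  have "norm (x * of_real (p ^ Suc n)) = norm x * (q * p ^ n) * q"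
    using p_pos by (simp add: norm_mult norm_power p_eq power2_eq_square mult_ac)
  then have "norm (x * of_real (p ^ Suc n)) \<le> q" using x by simp
  then have "qprod q \<le> norm (poch (x * of_real (p ^ Suc n)) l)" by (rule norm_poch_ge_inside)
  moreover have "qprod q \<le> norm (poch x (Suc n)) * (q * p ^ n)"
    using norm_poch_ge_outside[of x n "Suc n"] x by simp
  ultimately have "qprod q * qprod q
     \<le> norm (poch x (Suc n)) * (q * p ^ n) * norm (poch (x * of_real (p ^ Suc n)) l)"
    using qprod_q q_pos p_pos by (intro mult_mono) auto
  then show ?thesis
    unfolding l poch_add by (simp add: norm_mult power2_eq_square mult_ac)
qed

lemma qprod_shift_le_circle:
  fixes x :: "'a::{real_normed_field,banach}"
  assumes x: "norm x * (q * p ^ n) = 1" and m: "1 \<le> m"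
  shows "norm (qprod (x * of_real (p ^ m))) \<le> norm (qprod x) * (q * p ^ n / (qprod q)\<^sup>2)"
proof -
  have "(qprod q)\<^sup>2 * norm (qprod (x * of_real (p ^ m)))
     \<le> norm (poch x m) * (q * p ^ n) * norm (qprod (x * of_real (p ^ m)))"
    by (intro mult_right_mono norm_poch_ge_circle assms) auto
  also have "\<dots> = norm (qprod x) * (q * p ^ n)"
    by (subst qprod_split[of x m]) (simp add: norm_mult mult_ac)
  finally show ?thesis
    using qprod_q by (simp add: field_simps)
qed

lemma qprod_nonzero_circle:
  fixes x :: "'a::{real_normed_field,banach}"
  assumes x: "norm x * (q * p ^ n) = 1"
  shows "qprod x \<noteq> 0"
proof -
  have "(qprod q)\<^sup>2 \<le> norm (qprod x) * (q * p ^ n)"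
    using norm_poch_ge_circle[OF x]
    by (intro LIMSEQ_le_const[OF tendsto_mult_right[OF poch_tendsto_norm]]) auto
  then show ?thesis using qprod_q by auto
qed

lemma qbessel_eq_suminf: "qbessel w x = (\<Sum>m. coef m * w ^ m * qprod (x * p ^ m))"
  using qbessel_commute[of w x] by (simp add: qbessel_def)

section \<open>Counting zeros\<close>

text \<open>
  This is the hypothesis of Rouche's theorem on the circle: for \<open>m \<ge> 1\<close> the value \<open>qprod (x p^m)\<close> is at most
  \<open>q p^n / (q; p)\<^sup>2\<close> times \<open>qprod x\<close> in absolute value, and the weights \<open>\<bar>e\<^sub>m\<bar> w^m\<close> sum to less than \<open>qprod (- w)\<close>.
\<close>

lemma qbessel_close_to_qprod:
  fixes x :: "'a::{real_normed_field,banach}"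
  assumes x: "norm x * (q * p ^ n) = 1" and small: "q * p ^ n * qprod (- w) < (qprod q)\<^sup>2"
  shows "norm (qbessel (of_real w) x - qprod x) < norm (qprod x)"
proof -
  let ?K = "norm (qprod x) * (q * p ^ n / (qprod q)\<^sup>2)"
  let ?f = "\<lambda>m. of_real (coef m) * of_real w ^ m * qprod (x * of_real (p ^ m)) :: 'a"
  have "qbessel (of_real w) x = (\<Sum>m. ?f m)"
    by (subst qbessel_commute) (simp add: qbessel_def)
  then have "qbessel (of_real w) x - qprod x = (\<Sum>m. ?f (Suc m))"
    using suminf_split_head[OF summable_qbessel[of "of_real w" x]] by simp
  also have "norm \<dots> \<le> (\<Sum>m. \<bar>coef (Suc m)\<bar> * w ^ Suc m * ?K)"
  proof (rule norm_suminf_le)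
    show "norm (?f (Suc m)) \<le> \<bar>coef (Suc m)\<bar> * w ^ Suc m * ?K" for m
      using qprod_shift_le_circle[OF x, of "Suc m"] w_pos
      unfolding norm_mult norm_power norm_of_real by (intro mult_mono) auto
    show "summable (\<lambda>m. \<bar>coef (Suc m)\<bar> * w ^ Suc m * ?K)"
      using summable_abs_coef[of w] by (intro summable_mult2) (subst summable_Suc_iff)
  qed
  also have "\<dots> = (qprod (- w) - 1) * ?K"
  proof -
    have s: "summable (\<lambda>m. \<bar>coef (Suc m)\<bar> * w ^ Suc m)"
      using summable_abs_coef[of w] by (subst summable_Suc_iff)
    have e: "(\<Sum>m. \<bar>coef (Suc m)\<bar> * w ^ Suc m) = qprod (- w) - 1"
      using suminf_split_head[OF summable_abs_coef[of w]] by (simp add: qprod_neg_eq)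
    show ?thesis by (simp only: suminf_mult2[OF s, symmetric] e)
  qed
  also have "\<dots> \<le> qprod (- w) * ?K"
    using q_pos p_pos by (intro mult_right_mono) auto
  also have "\<dots> = norm (qprod x) * (q * p ^ n * qprod (- w) / (qprod q)\<^sup>2)" by simp
  also have "\<dots> < norm (qprod x) * 1"
    using qprod_nonzero_circle[OF x] small qprod_q by (intro mult_strict_left_mono) auto
  finally show ?thesis by simp
qed

text \<open>
  Inside the circle, the infinite product has its simple zeros \<open>1, 1/p, \<dots>, 1/p^n\<close> and no others. By Rouche's theorem
  the zeros of the perturbed function, counted with multiplicity, are as many, so distinct ones are at most as
  many.
\<close>

lemma card_zeros_le:
  assumes small: "q * p ^ n * qprod (- w) < (qprod q)\<^sup>2"
    and A: "\<And>a. a \<in> A \<Longrightarrow> 0 < a \<and> a * (q * p ^ n) < 1 \<and> qbessel w a = 0"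
  shows "card A \<le> Suc n"
proof -
  \<comment> \<open>The ball \<open>S\<close> is slightly larger than the disc of radius \<open>R\<close>, but still contains no zero of \<open>qprod\<close> beyond \<open>1 / p ^ n\<close>.\<close>
  define R where "R = 1 / (q * p ^ n)"
  define S where "S = ball (0::complex) (1 / p ^ Suc n)"
  define F where "F = (qbessel (of_real w) :: complex \<Rightarrow> complex)"
  define ZF where "ZF = {z\<in>S. F z = 0}"
  define ZE where "ZE = {z\<in>S. qprod z = 0}"
  define \<gamma> where "\<gamma> = circlepath 0 R"
  have R_pos: "0 < R" using q_pos p_pos by (simp add: R_def)
  have R_less: "R < 1 / p ^ Suc n"
    using p_less_q p_pos q_pos by (simp add: R_def frac_less2)
  have F_hol: "F holomorphic_on B" for B
    unfolding F_def by (rule qbessel_holomorphic)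
  have F0: "F 0 \<noteq> 0"
    using qprod_pos[of w] w_less_1 by (simp add: F_def qbessel_0 qprod_of_real)
  have fin_ZF: "finite ZF"
  proof (cases "F constant_on UNIV")
    case True
    then have "ZF = {}" using F0 by (auto simp: constant_on_def ZF_def)
    then show ?thesis by simp
  next
    case False
    show ?thesis
    proof (rule finite_subset)
      show "finite {z \<in> cball 0 (1 / p ^ Suc n). F z = 0}"
        by (rule holomorphic_compact_finite_zeros[OF F_hol _ _ _ _ False]) auto
    qed (auto simp: ZF_def S_def)
  qed
  have ZE_eq: "ZE = (\<lambda>i. of_real (1 / p ^ i)) ` {..<Suc n}"
  proof -
    have "norm z * p ^ Suc n < 1" if "z \<in> S" for z
      using that p_pos by (simp add: S_def field_simps)
    moreover have "of_real (1 / p ^ i) \<in> S" if "i < Suc n" for i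
    proof -
      have "1 / p ^ i < 1 / p ^ Suc n"
        using that p_pos p_less_1 by (intro divide_strict_left_mono power_strict_decreasing) auto
      then show ?thesis using p_pos by (simp add: S_def norm_divide norm_power)
    qed
    ultimately show ?thesis
      unfolding ZE_def using qprod_zero_iff[of _ "Suc n"] by blast
  qed
  then have fin_ZE: "finite ZE" and card_ZE: "card ZE \<le> Suc n"
    using card_image_le[of "{..<Suc n}" "\<lambda>i. of_real (1 / p ^ i) :: complex"] by auto
  have W: "winding_number \<gamma> z = (if norm z < R then 1 else 0)" if "norm z \<noteq> R" for z
  proof (cases "norm z < R")
    case True
    then show ?thesis using winding_number_circlepath[of z 0 R] by (simp add: \<gamma>_def)
  next
    case False
    have "winding_number \<gamma> z = 0"
      using False that R_pos
      by (intro winding_number_zero_outside[of _ "cball 0 R"]) (auto simp: \<gamma>_def)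
    with False show ?thesis by simp
  qed
  have close: "norm (F z - qprod z) < norm (qprod z)" if "norm z = R" for z
    unfolding F_def using that q_pos p_pos by (intro qbessel_close_to_qprod[OF _ small]) (simp add: R_def)
  have rouche: "(\<Sum>z\<in>ZF. winding_number \<gamma> z * zorder F z) = (\<Sum>z\<in>ZE. winding_number \<gamma> z * zorder qprod z)"
  proof -
    have "(\<Sum>z\<in>{z\<in>S. qprod z + (F z - qprod z) = 0}. winding_number \<gamma> z * zorder (\<lambda>z. qprod z + (F z - qprod z)) z)
        = (\<Sum>z\<in>{z\<in>S. qprod z = 0}. winding_number \<gamma> z * zorder qprod z)"
    proof (rule Rouche_theorem)
      show "finite {z\<in>S. qprod z + (F z - qprod z) = 0}" "finite {z\<in>S. qprod z = 0}"
        using fin_ZF fin_ZE by (simp_all add: ZF_def ZE_def)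
      show "path_image \<gamma> \<subseteq> S"
        using R_pos R_less by (auto simp: \<gamma>_def S_def)
      show "\<forall>z\<in>path_image \<gamma>. cmod (F z - qprod z) < cmod (qprod z)"
        using close R_pos by (auto simp: \<gamma>_def)
      show "\<forall>z. z \<notin> S \<longrightarrow> winding_number \<gamma> z = 0"
        using R_less W by (auto simp: S_def)
    qed (auto simp: S_def \<gamma>_def intro!: holomorphic_intros qprod_holomorphic F_hol)
    then show ?thesis by (simp add: ZF_def ZE_def)
  qed
  have not_R: "norm z \<noteq> R" if "F z = 0 \<or> qprod z = 0" for z
    using close[of z] that by auto
  define ZF' where "ZF' = {z\<in>ZF. norm z < R}"
  have "(\<Sum>z\<in>ZF. winding_number \<gamma> z * zorder F z) = (\<Sum>z\<in>ZF'. of_int (zorder F z))"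
    unfolding ZF'_def using fin_ZF
    by (intro sum.mono_neutral_cong_right) (auto simp: W not_R ZF_def)
  moreover have "(\<Sum>z\<in>ZE. winding_number \<gamma> z * zorder qprod z) = (\<Sum>z\<in>{z\<in>ZE. norm z < R}. 1)"
  proof (rule sum.mono_neutral_cong_right)
    have ord: "zorder qprod z = 1" if "z \<in> ZE" for z
      using that zorder_qprod[of _ "Suc n"] unfolding ZE_eq by auto
    have nR: "norm z \<noteq> R" if "z \<in> ZE" for z
      using that not_R by (auto simp: ZE_def)
    show "\<forall>z\<in>ZE - {z\<in>ZE. norm z < R}. winding_number \<gamma> z * of_int (zorder qprod z) = 0"
      using nR by (auto simp: W)
    show "winding_number \<gamma> z * of_int (zorder qprod z) = 1" if "z \<in> {z\<in>ZE. norm z < R}" for z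
      using that ord nR by (simp add: W)
  qed (use fin_ZE in auto)
  ultimately have "(\<Sum>z\<in>ZF'. of_int (zorder F z) :: complex) = of_nat (card {z\<in>ZE. norm z < R})"
    using rouche by simp
  then have "(of_int (\<Sum>z\<in>ZF'. zorder F z) :: complex) = of_int (int (card {z\<in>ZE. norm z < R}))"
    by simp
  then have eq: "(\<Sum>z\<in>ZF'. zorder F z) = int (card {z\<in>ZE. norm z < R})"
    by (simp only: of_int_eq_iff)
  \<comment> \<open>Zeros of \<open>F\<close> in \<open>S\<close> are finitely many, hence isolated, which makes their orders positive.\<close>
  have "zorder F z \<ge> 1" if "z \<in> ZF'" for z
  proof -
    have "frequently (\<lambda>z. F z \<noteq> 0) (at z)"
    proof -
      have "open (S - (ZF - {z}))"
        using fin_ZF by (auto simp: S_def intro!: open_Diff finite_imp_closed)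
      then have "\<forall>\<^sub>F u in at z. u \<in> S - (ZF - {z}) - {z}"
        using that by (intro eventually_at_in_open) (auto simp: ZF'_def ZF_def)
      then have "\<forall>\<^sub>F u in at z. F u \<noteq> 0"
        by eventually_elim (auto simp: ZF_def)
      then show ?thesis by (simp add: eventually_frequently)
    qed
    then have "zorder F z > 0"
      using zorder_pos_iff[OF F_hol, of UNIV z] that by (auto simp: ZF'_def ZF_def)
    then show ?thesis by simp
  qed
  then have "int (card ZF') \<le> (\<Sum>z\<in>ZF'. zorder F z)"
    using sum_mono[of ZF' "\<lambda>_. 1" "zorder F"] by simp
  moreover have "card {z\<in>ZE. norm z < R} \<le> card ZE"
    using fin_ZE by (intro card_mono) auto
  ultimately have card_ZF': "card ZF' \<le> Suc n" using eq card_ZE by linarith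
  have sub: "of_real ` A \<subseteq> ZF'"
  proof (rule image_subsetI)
    fix a assume "a \<in> A"
    then have a: "0 < a" "a * (q * p ^ n) < 1" "qbessel w a = 0" using A by auto
    then have "a < R" using q_pos p_pos by (simp add: R_def field_simps)
    then show "of_real a \<in> ZF'"
      using a R_less by (simp add: ZF'_def ZF_def S_def F_def qbessel_of_real)
  qed
  have inj: "inj_on (of_real :: real \<Rightarrow> complex) A" by (simp add: inj_on_def)
  have "finite ZF'" using fin_ZF by (simp add: ZF'_def)
  then show "card A \<le> Suc n"
    using card_mono[OF _ sub] card_image[OF inj] card_ZF' by simp
qed

section \<open>The function one step below a zero\<close>

text \<open>
  The factor \<open>qprod (- p)\<close> pays for replacing \<open>y\<close> by \<open>1\<close>: for \<open>u \<le> p \<le> y\<close> one has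
  \<open>1 - y u \<le> 1 - u\<^sup>2 = (1 - u) (1 + u)\<close>.
\<close>

lemma qprod_shift_bounds:
  assumes y: "q \<le> y" "y * q \<le> 1"
  shows "0 \<le> qprod (y * p ^ Suc j)" and "qprod (y * p ^ Suc j) \<le> qprod p * qprod (- p) / qpoch p p j"
proof -
  have yp: "y * p \<le> q"
    using mult_right_mono[OF y(2), of q] q_pos by (simp add: p_eq power2_eq_square mult_ac)
  have y_pos: "0 < y" using y q_pos by linarith
  have pj: "p ^ Suc j \<le> p" using p_pos p_power_le_1[of j] by (simp add: mult_left_le)
  have "y * p ^ Suc j \<le> y * p" using pj y_pos by (intro mult_left_mono) auto
  then have "y * p ^ Suc j < 1" using yp q_less_1 by linarith
  then show "0 \<le> qprod (y * p ^ Suc j)" by (intro less_imp_le qprod_pos)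
  let ?u = "p ^ Suc j"
  have "qpoch (y * ?u) p n \<le> qpoch ?u p n * qpoch (- ?u) p n" for n
    unfolding qpoch_def prod.distrib[symmetric]
  proof (intro prod_mono conjI)
    fix i
    define v where "v = ?u * p ^ i"
    have "v \<le> ?u"
      unfolding v_def using p_pos by (intro mult_left_le p_power_le_1) auto
    then have v: "v \<le> p" using pj by linarith
    have v_pos: "0 < v" using p_pos by (simp add: v_def)
    have "y * v \<le> y * p" using v y_pos by (intro mult_left_mono) auto
    then show "0 \<le> 1 - y * ?u * p ^ i"
      using yp q_less_1 by (simp add: v_def mult.assoc)
    have "v * v \<le> y * v"
      using v v_pos y p_less_q by (intro mult_right_mono) auto
    then show "1 - y * ?u * p ^ i \<le> (1 - ?u * p ^ i) * (1 - - ?u * p ^ i)"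
      unfolding mult.assoc[of y] minus_mult_left[symmetric] v_def[symmetric]
      by (simp add: algebra_simps)
  qed
  then have "qprod (y * ?u) \<le> qprod ?u * qprod (- ?u)"
    by (intro LIMSEQ_le[OF qpoch_tendsto tendsto_mult[OF qpoch_tendsto qpoch_tendsto]]) auto
  also have "\<dots> \<le> qprod ?u * qprod (- p)"
  proof (intro mult_left_mono qprod_antimono)
    have "0 < ?u" using p_pos by simp
    then show "- ?u < 1" by linarith
    show "0 \<le> qprod ?u" using pj p_less_1 by (intro less_imp_le qprod_pos) linarith
  qed (use pj in simp)
  also have "qprod ?u = qprod p / qpoch p p j"
    using qprod_split[of p j] qpoch_pos[OF p_less_1, of j] by (simp add: poch_real)
  finally show "qprod (y * p ^ Suc j) \<le> qprod p * qprod (- p) / qpoch p p j" by simp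
qed

lemma choose_two_add: "(L + j) choose 2 = (L choose 2) + (j choose 2) + L * j"
  by (induction j) (simp_all add: numeral_2_eq_2)

text \<open>
  These are the terms with index at least \<open>L\<close> in the expansion of \<open>qbessel w x\<close> at \<open>x = p y / p^L\<close>.
  The identity for \<open>(L + j) choose 2\<close> factors out \<open>w^L p^(L choose 2)\<close> and leaves the series of
  \<open>qprod (- (w p^L))\<close>; the infinite product \<open>(p; p)\<close> from the previous bound, divided by the part of it with
  \<open>L + j\<close> factors in the coefficient, is at most \<open>1\<close>.
\<close>

lemma tail_bound:
  assumes y: "q \<le> y" "y * q \<le> 1"
  shows "\<bar>\<Sum>j. coef (L + j) * w ^ (L + j) * qprod (y * p ^ Suc j)\<bar>
    \<le> w ^ L * p ^ (L choose 2) * qprod (- p) * qprod (- (w * p ^ L))"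
proof -
  let ?C = "w ^ L * p ^ (L choose 2) * qprod (- p)"
  have "norm (\<Sum>j. coef (L + j) * w ^ (L + j) * qprod (y * p ^ Suc j))
    \<le> (\<Sum>j. ?C * (\<bar>coef j\<bar> * (w * p ^ L) ^ j))"
  proof (rule norm_suminf_le)
    show "summable (\<lambda>j. ?C * (\<bar>coef j\<bar> * (w * p ^ L) ^ j))"
      by (intro summable_mult summable_abs_coef)
    fix j
    have qp: "0 < qpoch p p (L + j)" "0 < qpoch p p j" by (rule qpoch_pos[OF p_less_1])+
    have "qprod p \<le> qpoch p p (L + j)"
      using p_pos p_less_1 by (intro qprod_le_qpoch) auto
    then have ratio: "qprod p / qpoch p p (L + j) \<le> 1" using qp by simp
    have "norm (coef (L + j) * w ^ (L + j) * qprod (y * p ^ Suc j))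
      = \<bar>coef (L + j)\<bar> * w ^ (L + j) * qprod (y * p ^ Suc j)"
      using qprod_shift_bounds(1)[OF y] w_pos by (simp add: abs_mult)
    also have "\<dots> \<le> \<bar>coef (L + j)\<bar> * w ^ (L + j) * (qprod p * qprod (- p) / qpoch p p j)"
      using w_pos by (intro mult_left_mono qprod_shift_bounds(2) y) auto
    also have "\<dots> = ?C * (\<bar>coef j\<bar> * (w * p ^ L) ^ j) * (qprod p / qpoch p p (L + j))"
      by (simp add: abs_coef choose_two_add power_add power_mult power_mult_distrib mult_ac)
    also have "\<dots> \<le> ?C * (\<bar>coef j\<bar> * (w * p ^ L) ^ j)"
      using w_pos p_pos qprod_pos[of "- p"] ratio by (intro mult_left_le) auto
    finally show "norm (coef (L + j) * w ^ (L + j) * qprod (y * p ^ Suc j))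
      \<le> ?C * (\<bar>coef j\<bar> * (w * p ^ L) ^ j)" .
  qed
  also have "\<dots> = ?C * qprod (- (w * p ^ L))"
    unfolding qprod_neg_eq by (intro suminf_mult summable_abs_coef)
  finally show ?thesis by simp
qed

lemma qbessel_split:
  "qbessel w x = (\<Sum>m<L. coef m * w ^ m * qprod (x * p ^ m))
     + (\<Sum>j. coef (L + j) * w ^ (L + j) * qprod (x * p ^ (L + j)))"
  unfolding qbessel_eq_suminf
  using suminf_split_initial_segment[of "\<lambda>m. coef m * w ^ m * qprod (x * p ^ m)" L] summable_qbessel[of w x]
  by (simp add: add.commute)

text \<open>
  From here on \<open>a = y / p^M\<close> with \<open>M = n + 1\<close> is a zero, and \<open>n\<close> is so large that the terms of index \<open>1, \<dots>, M\<close> in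
  the expansion of \<open>qbessel w a\<close> add up to at most half of the leading term \<open>qprod a\<close>.
\<close>

context
  fixes n :: nat and a y :: real
  assumes y: "q \<le> y" "y * q \<le> 1" and a_eq: "a * p ^ Suc n = y"
    and zero: "qbessel w a = 0"
    and small: "q * p ^ n / qprod q * qprod (- w) \<le> 1 / 2"
begin

lemma a_ge: "1 \<le> \<bar>a\<bar> * (q * p ^ n)"
proof -
  have "a * (q * p ^ n) * q = y"
    using a_eq by (simp add: p_eq power2_eq_square mult_ac)
  then have "1 * q \<le> a * (q * p ^ n) * q" using y by simp
  then have "1 \<le> a * (q * p ^ n)" using q_pos by (rule mult_right_le_imp_le)
  also have "\<dots> \<le> \<bar>a\<bar> * (q * p ^ n)" using q_pos p_pos by (intro mult_right_mono) auto
  finally show ?thesis .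
qed

lemma qprod_shift_le_at_zero:
  assumes "1 \<le> m" "m \<le> Suc n"
  shows "\<bar>qprod (a * p ^ m)\<bar> \<le> \<bar>qprod a\<bar> * (q * p ^ n / qprod q)"
proof -
  have "qprod q * \<bar>qprod (a * p ^ m)\<bar> \<le> \<bar>poch a m\<bar> * (q * p ^ n) * \<bar>qprod (a * p ^ m)\<bar>"
    using norm_poch_ge_outside[of a n m] a_ge assms by (intro mult_right_mono) auto
  also have "\<dots> = \<bar>qprod a\<bar> * (q * p ^ n)"
    by (subst qprod_split[of a m]) (simp add: abs_mult mult_ac)
  finally show ?thesis using qprod_q by (simp add: field_simps)
qed

lemma sum_abs_coef_le: "finite A \<Longrightarrow> (\<Sum>m\<in>A. \<bar>coef m\<bar> * w ^ m) \<le> qprod (- w)"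
  unfolding qprod_neg_eq using w_pos by (intro sum_le_suminf summable_abs_coef) auto

text \<open>
  The exponent map \<open>h\<close> allows two uses: the identity for the expansion at the zero \<open>a\<close>, the successor function for the
  expansion at \<open>p * a\<close>.
\<close>

lemma head_bound:
  assumes "\<And>m. m \<in> A \<Longrightarrow> 1 \<le> h m \<and> h m \<le> Suc n" and "finite A"
  shows "\<bar>\<Sum>m\<in>A. coef m * w ^ m * qprod (a * p ^ h m)\<bar> \<le> \<bar>qprod a\<bar> / 2"
proof -
  let ?K = "q * p ^ n / qprod q"
  have "\<bar>\<Sum>m\<in>A. coef m * w ^ m * qprod (a * p ^ h m)\<bar>
      \<le> (\<Sum>m\<in>A. \<bar>coef m\<bar> * w ^ m * (\<bar>qprod a\<bar> * ?K))"
  proof (rule order.trans[OF sum_abs sum_mono])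
    fix m assume "m \<in> A"
    then show "\<bar>coef m * w ^ m * qprod (a * p ^ h m)\<bar> \<le> \<bar>coef m\<bar> * w ^ m * (\<bar>qprod a\<bar> * ?K)"
      using assms(1) qprod_shift_le_at_zero[of "h m"] w_pos
      by (simp only: abs_mult power_abs) (intro mult_mono, auto)
  qed
  also have "\<dots> = (\<Sum>m\<in>A. \<bar>coef m\<bar> * w ^ m) * (\<bar>qprod a\<bar> * ?K)"
    by (simp only: sum_distrib_right)
  also have "\<dots> \<le> qprod (- w) * (\<bar>qprod a\<bar> * ?K)"
    using sum_abs_coef_le[OF assms(2)] q_pos p_pos qprod_q by (intro mult_right_mono) auto
  also have "\<dots> = \<bar>qprod a\<bar> * (?K * qprod (- w))" by simp
  also have "\<dots> \<le> \<bar>qprod a\<bar> * (1 / 2)" using small by (intro mult_left_mono) auto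
  finally show ?thesis by simp
qed

text \<open>
  In \<open>0 = qprod a + head + tail\<close> the head is at most half of \<open>qprod a\<close> in absolute value, so \<open>qprod a\<close> is at most
  twice the tail.
\<close>

lemma qprod_at_zero_le:
  "\<bar>qprod a\<bar> \<le> 2 * (w ^ Suc (Suc n) * p ^ (Suc (Suc n) choose 2) * qprod (- p) * qprod (- w))"
proof -
  let ?L = "Suc (Suc n)"
  let ?T = "\<Sum>j. coef (?L + j) * w ^ (?L + j) * qprod (a * p ^ (?L + j))"
  let ?H = "\<Sum>m\<in>{1..<?L}. coef m * w ^ m * qprod (a * p ^ m)"
  have "(\<Sum>m<?L. coef m * w ^ m * qprod (a * p ^ m)) = qprod a + ?H"
    by (subst lessThan_atLeast0, subst sum.atLeast_Suc_lessThan) auto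
  then have "qprod a + ?H + ?T = 0"
    using qbessel_split[of a ?L] zero by simp
  moreover have "\<bar>?H\<bar> \<le> \<bar>qprod a\<bar> / 2" by (rule head_bound) auto
  ultimately have "\<bar>qprod a\<bar> \<le> 2 * \<bar>?T\<bar>" by linarith
  moreover have "a * p ^ (?L + j) = y * p ^ Suc j" for j
    using a_eq[symmetric] by (simp add: power_add mult_ac)
  then have "\<bar>?T\<bar> \<le> w ^ ?L * p ^ (?L choose 2) * qprod (- p) * qprod (- (w * p ^ ?L))"
    using tail_bound[OF y, of ?L] by presburger
  moreover have "\<dots> \<le> w ^ ?L * p ^ (?L choose 2) * qprod (- p) * qprod (- w)"
  proof (intro mult_left_mono qprod_antimono)
    show "- w \<le> - (w * p ^ ?L)"
      using w_pos mult_left_le[OF p_power_le_1[of ?L], of w] by simp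
    have "0 < w * p ^ ?L" using w_pos p_pos by simp
    then show "- (w * p ^ ?L) < 1" by linarith
  qed (use w_pos p_pos qprod_pos[of "- p"] in auto)
  ultimately show ?thesis by linarith
qed

text \<open>
  The head of the expansion at \<open>p * a\<close> is again at most half of \<open>qprod a\<close>, hence of the order
  \<open>w^(M+1) p^((M+1) choose 2)\<close>. Compared with the tail, of order \<open>w^M p^(M choose 2)\<close>, it is smaller by the
  factor \<open>w p^M\<close>, which is estimated by \<open>p^n\<close>.
\<close>

lemma qbessel_next_le:
  "\<bar>qbessel w (p * a)\<bar> \<le> w ^ Suc n * p ^ (Suc n choose 2) * qprod (- p)
      * (qprod (- (w * p ^ Suc n)) + p ^ n * qprod (- w))"
proof -
  let ?L = "Suc n"
  let ?T = "\<Sum>j. coef (?L + j) * w ^ (?L + j) * qprod (p * a * p ^ (?L + j))"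
  let ?H = "\<Sum>m<?L. coef m * w ^ m * qprod (a * p ^ Suc m)"
  have "qbessel w (p * a) = ?H + ?T"
    using qbessel_split[of "p * a" ?L] by (simp add: mult_ac)
  then have "\<bar>qbessel w (p * a)\<bar> \<le> \<bar>?H\<bar> + \<bar>?T\<bar>" by linarith
  also have "\<bar>?H\<bar> \<le> \<bar>qprod a\<bar> / 2" by (rule head_bound) auto
  also have "\<bar>qprod a\<bar> / 2 \<le> w ^ Suc (Suc n) * p ^ (Suc (Suc n) choose 2) * qprod (- p) * qprod (- w)"
    using qprod_at_zero_le by simp
  also have "\<dots> = w ^ ?L * p ^ (?L choose 2) * qprod (- p) * ((w * p) * (p ^ n * qprod (- w)))"
    by (simp add: numeral_2_eq_2 power_add mult_ac)
  also have "\<dots> \<le> w ^ ?L * p ^ (?L choose 2) * qprod (- p) * (p ^ n * qprod (- w))"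
    using w_pos w_less_1 p_pos p_less_1 qprod_pos[of "- p"] qprod_pos[of "- w"]
    by (intro mult_left_mono mult_left_le_one_le mult_le_one) auto
  also have "p * a * p ^ (?L + j) = y * p ^ Suc j" for j
    using a_eq[symmetric] by (simp add: power_add mult_ac)
  then have "\<bar>?T\<bar> \<le> w ^ ?L * p ^ (?L choose 2) * qprod (- p) * qprod (- (w * p ^ ?L))"
    using tail_bound[OF y, of ?L] by presburger
  finally show ?thesis by (simp add: algebra_simps)
qed

text \<open>
  The linear factor \<open>1 - y\<close> of \<open>qprod a\<close> is responsible for its smallness, since all other factors are bounded below.
\<close>

lemma zero_near_power:
  "\<bar>1 - y\<bar> \<le> 2 * qprod (- p) * qprod (- w) / (qprod q)\<^sup>2 * p ^ n"
proof -
  have "qprod a = poch a (Suc n) * ((1 - y) * qprod (y * p))"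
    using qprod_split[of a "Suc n"] qprod_rec[of "y"] a_eq by simp
  then have "\<bar>qprod a\<bar> * (q * p ^ n) = \<bar>poch a (Suc n)\<bar> * (q * p ^ n) * (\<bar>1 - y\<bar> * \<bar>qprod (y * p)\<bar>)"
    by (simp add: abs_mult)
  also have "\<dots> \<ge> qprod q * (\<bar>1 - y\<bar> * qprod q)"
  proof (intro mult_mono)
    show "qprod q \<le> \<bar>poch a (Suc n)\<bar> * (q * p ^ n)"
      using norm_poch_ge_outside[of a n "Suc n"] a_ge by simp
    have "y * p \<le> q"
      using mult_right_mono[OF y(2), of q] q_pos by (simp add: p_eq power2_eq_square mult_ac)
    then show "qprod q \<le> \<bar>qprod (y * p)\<bar>"
      using qprod_antimono[of "y * p" q] q_less_1 by linarith
  qed (use qprod_q q_pos p_pos in auto)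
  finally have 1: "(qprod q)\<^sup>2 * \<bar>1 - y\<bar> \<le> \<bar>qprod a\<bar> * (q * p ^ n)"
    by (simp add: power2_eq_square mult_ac)
  have "\<bar>qprod a\<bar> \<le> 2 * (w ^ Suc (Suc n) * p ^ (Suc (Suc n) choose 2)) * (qprod (- p) * qprod (- w))"
    using qprod_at_zero_le by (simp add: mult_ac)
  also have "\<dots> \<le> 2 * 1 * (qprod (- p) * qprod (- w))"
    using qprod_pos[of "- p"] qprod_pos[of "- w"] w_pos w_less_1 p_pos p_less_1
    by (intro mult_right_mono mult_left_mono mult_le_one power_le_one) auto
  finally have "\<bar>qprod a\<bar> * (q * p ^ n) \<le> 2 * qprod (- p) * qprod (- w) * (q * p ^ n)"
    using q_pos p_pos by (intro mult_right_mono) auto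
  also have "\<dots> \<le> 2 * qprod (- p) * qprod (- w) * (1 * p ^ n)"
    using q_less_1 q_pos p_pos qprod_pos[of "- p"] qprod_pos[of "- w"] w_pos
    by (intro mult_left_mono mult_right_mono) auto
  finally show ?thesis using 1 qprod_q by (simp add: field_simps)
qed

end

lemma p_power_tendsto_0: "(\<lambda>n. p ^ n) \<longlonglongrightarrow> 0"
  using p_pos p_less_1 by (intro LIMSEQ_power_zero) auto

text \<open>
  The right-hand side exceeds the asymptotic size of the left-hand side by at least the factor \<open>qprod (- w) > 1\<close>. Half of
  it, on the logarithmic scale, is spent on \<open>y powr r\<close> and the other half on the bracket in \<open>qbessel_next_le\<close>; both
  tend to \<open>1\<close>.
\<close>

lemma qbessel_next_zero_eventually:
  fixes r :: real
  shows "\<forall>\<^sub>F n in sequentially. \<forall>y. q \<le> y \<longrightarrow> y * q \<le> 1 \<longrightarrow> qbessel w (y / p ^ Suc n) = 0 \<longrightarrow>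
     y powr r * \<bar>qbessel w (p * (y / p ^ Suc n))\<bar> \<le> w ^ Suc n * p ^ (Suc n choose 2) * qprod (- p) * qprod (- w)"
proof -
  define \<kappa> where "\<kappa> = sqrt (qprod (- w))"
  have "1 + w \<le> qprod (- w)"
    using qprod_rec[of "- w"] qprod_antimono[of "- w * p" 0] w_pos p_pos by simp
  then have \<kappa>: "1 < \<kappa>" "\<kappa> * \<kappa> = qprod (- w)"
    using w_pos by (auto simp: \<kappa>_def)
  have "((\<lambda>y. y powr r) \<longlongrightarrow> 1 powr r) (nhds (1::real))"
    by (intro tendsto_intros) (auto simp: filterlim_ident)
  then have "\<forall>\<^sub>F y in nhds 1. y powr r < \<kappa>"
    using \<kappa> by (intro order_tendstoD(2)[where a = \<kappa>]) auto
  then obtain \<delta> where \<delta>: "\<delta> > 0" "\<And>y. \<bar>1 - y\<bar> < \<delta> \<Longrightarrow> y powr r < \<kappa>"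
    by (auto simp: eventually_nhds_metric dist_real_def abs_minus_commute)
  have "(\<lambda>n. q * p ^ n / qprod q * qprod (- w)) \<longlonglongrightarrow> q * 0 / qprod q * qprod (- w)"
    using qprod_q by (intro tendsto_intros p_power_tendsto_0) auto
  then have ev1: "\<forall>\<^sub>F n in sequentially. q * p ^ n / qprod q * qprod (- w) < 1 / 2"
    by (intro order_tendstoD(2)) auto
  have "(\<lambda>n. 2 * qprod (- p) * qprod (- w) / (qprod q)\<^sup>2 * p ^ n) \<longlonglongrightarrow> 2 * qprod (- p) * qprod (- w) / (qprod q)\<^sup>2 * 0"
    by (intro tendsto_intros p_power_tendsto_0)
  then have ev2: "\<forall>\<^sub>F n in sequentially. 2 * qprod (- p) * qprod (- w) / (qprod q)\<^sup>2 * p ^ n < \<delta>"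
    using \<delta> by (intro order_tendstoD(2)) auto
  have "(\<lambda>n. qprod (- (w * p ^ Suc n))) \<longlonglongrightarrow> 1"
    using LIMSEQ_Suc[OF qprod_shift_tendsto_1[of "- w"]] by simp
  then have "(\<lambda>n. qprod (- (w * p ^ Suc n)) + p ^ n * qprod (- w)) \<longlonglongrightarrow> 1 + 0 * qprod (- w)"
    by (intro tendsto_intros p_power_tendsto_0)
  then have ev3: "\<forall>\<^sub>F n in sequentially. qprod (- (w * p ^ Suc n)) + p ^ n * qprod (- w) < \<kappa>"
    using \<kappa> by (intro order_tendstoD(2)) auto
  from ev1 ev2 ev3 show ?thesis
  proof eventually_elim
    case (elim n)
    show ?case
    proof (intro allI impI)
      fix y assume y: "q \<le> y" "y * q \<le> 1" and zero: "qbessel w (y / p ^ Suc n) = 0"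
      have a_eq: "y / p ^ Suc n * p ^ Suc n = y" using p_pos by simp
      note facts = y a_eq zero less_imp_le[OF elim(1)]
      let ?C = "w ^ Suc n * p ^ (Suc n choose 2) * qprod (- p)"
      have C: "0 \<le> ?C" using w_pos p_pos qprod_pos[of "- p"] by simp
      have "y powr r * \<bar>qbessel w (p * (y / p ^ Suc n))\<bar> \<le> \<kappa> * (?C * \<kappa>)"
      proof (intro mult_mono)
        show "y powr r \<le> \<kappa>"
          using zero_near_power[OF facts] elim(2) by (intro less_imp_le \<delta>) linarith
        show "\<bar>qbessel w (p * (y / p ^ Suc n))\<bar> \<le> ?C * \<kappa>"
          using qbessel_next_le[OF facts] mult_left_mono[OF less_imp_le[OF elim(3)] C] by linarith
      qed (use \<kappa> in auto)
      then show "y powr r * \<bar>qbessel w (p * (y / p ^ Suc n))\<bar> \<le> ?C * qprod (- w)"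
        by (simp add: \<kappa>(2)[symmetric] mult_ac)
    qed
  qed
qed

section \<open>Zeros of the third Jackson Bessel function\<close>

lemma hahn_exton_J_eq:
  assumes w: "w = q powr (2 * (\<nu> + 1))" and z: "z > 0"
  shows "hahn_exton_J q \<nu> z = z powr \<nu> / qprod p * qbessel w (p * z\<^sup>2)"
proof -
  have ew: "qprod w \<noteq> 0" using qprod_pos[OF w_less_1] by simp
  have "coef k * (p * z\<^sup>2) ^ k * qprod (w * p ^ k) / qprod w
      = (-1) ^ k * (q ^ (k * (k + 1)) / (qpoch w p k * qpoch p p k)) * z ^ (2 * k)" for k
  proof -
    have "k * (k + 1) = 2 * (k choose 2) + 2 * k"
      by (induction k) (simp_all add: numeral_2_eq_2)
    then have "q ^ (k * (k + 1)) = p ^ (k choose 2) * p ^ k"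
      by (simp only: power_add power_mult p_eq)
    moreover have "qprod w = qpoch w p k * qprod (w * p ^ k)"
      using qprod_split[of w k] by (simp add: poch_real)
    moreover have "(p * z\<^sup>2) ^ k = p ^ k * z ^ (2 * k)"
      by (simp add: power_mult_distrib power_mult)
    ultimately show ?thesis
      using ew by (simp add: coef_def mult_ac)
  qed
  moreover have "(\<Sum>k. coef k * (p * z\<^sup>2) ^ k * qprod (w * p ^ k) / qprod w) = qbessel w (p * z\<^sup>2) / qprod w"
    unfolding qbessel_def using summable_qbessel[of "p * z\<^sup>2" w] by (subst suminf_divide) simp_all
  ultimately have "(\<Sum>k. (-1) ^ k * (q ^ (k * (k + 1)) / (qpoch w p k * qpoch p p k)) * z ^ (2 * k))
     = qbessel w (p * z\<^sup>2) / qprod w" by simp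
  then show ?thesis
    using ew unfolding hahn_exton_J_def w[symmetric] p_eq[symmetric] qpoch_inf_eq_qprod by simp
qed

end

theorem theorem3p9:
  fixes q \<nu> :: real and j :: "nat \<Rightarrow> real"
  assumes "0 < q" and "q < 1" and "\<nu> > -1"
    and "strict_mono_on {1..} j"
    and "j ` {1..} = {z. z > 0 \<and> hahn_exton_J q \<nu> z = 0}"
  shows "\<forall>\<^sub>F k in sequentially.
    \<bar>hahn_exton_J q \<nu> (q * j k)\<bar>
      \<le> qpoch_inf (- (q\<^sup>2)) (q\<^sup>2) * qpoch_inf (- (q powr (2 * (\<nu> + 1)))) (q\<^sup>2) / qpoch_inf (q\<^sup>2) (q\<^sup>2)
         * q powr ((real k + \<nu>) * (real k - 1))"
proof -
  define p where "p = q\<^sup>2"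
  define w where "w = q powr (2 * (\<nu> + 1))"
  interpret hahn_exton p q w
  proof
    show "0 < p" "p < 1" "0 < q" "p = q\<^sup>2" "0 < w"
      using assms(1,2) by (auto simp: p_def w_def power_less_one_iff)
    have "q powr (2 * (\<nu> + 1)) < q powr 0"
      using assms(1-3) by (intro powr_less_mono') auto
    then show "w < 1" using assms(1) by (simp add: w_def)
  qed
  define a where "a = (\<lambda>k. p * (j k)\<^sup>2)"
  have j_pos: "0 < j k" and j_zero: "hahn_exton_J q \<nu> (j k) = 0" if "1 \<le> k" for k
    using assms(5) that by blast+
  have j_less: "j i < j k" if "1 \<le> i" "i < k" for i k
    using strict_mono_onD[OF assms(4), of i k] that by simp
  have a_pos: "0 < a k" if "1 \<le> k" for k
    using j_pos[OF that] p_pos by (simp add: a_def)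
  have a_zero: "qbessel w (a k) = 0" if "1 \<le> k" for k
    using hahn_exton_J_eq[OF w_def j_pos[OF that]] j_zero[OF that] j_pos[OF that] qprod_pos[OF p_less_1]
    by (simp add: a_def)
  have a_less: "a i < a k" if "1 \<le> i" "i < k" for i k
    using j_less[OF that] j_pos[OF that(1)] p_pos by (simp add: a_def power_strict_mono)
  have "(\<lambda>n. q * p ^ n * qprod (- w)) \<longlonglongrightarrow> q * 0 * qprod (- w)"
    by (intro tendsto_intros p_power_tendsto_0)
  then have "\<forall>\<^sub>F n in sequentially. q * p ^ n * qprod (- w) < (qprod q)\<^sup>2"
    using qprod_q by (intro order_tendstoD(2)) auto
  then obtain N1 where small: "\<And>n. n \<ge> N1 \<Longrightarrow> q * p ^ n * qprod (- w) < (qprod q)\<^sup>2"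
    unfolding eventually_sequentially by blast
  obtain N2 where bound: "\<And>n y. n \<ge> N2 \<Longrightarrow> q \<le> y \<Longrightarrow> y * q \<le> 1 \<Longrightarrow> qbessel w (y / p ^ Suc n) = 0 \<Longrightarrow>
      y powr (\<nu> / 2) * \<bar>qbessel w (p * (y / p ^ Suc n))\<bar>
        \<le> w ^ Suc n * p ^ (Suc n choose 2) * qprod (- p) * qprod (- w)"
    using qbessel_next_zero_eventually[of "\<nu> / 2"] unfolding eventually_sequentially by blast
  \<comment> \<open>Otherwise \<open>a 1, \<dots>, a (n + 2)\<close> would all lie inside the circle of radius \<open>1 / (q * p ^ n)\<close>.\<close>
  have large: "1 \<le> a (Suc (Suc n)) * (q * p ^ n)" if "n \<ge> N1" for n
  proof (rule ccontr)
    assume not_large: "\<not> 1 \<le> a (Suc (Suc n)) * (q * p ^ n)"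
    have "card (a ` {1..Suc (Suc n)}) \<le> Suc n"
    proof (rule card_zeros_le[OF small[OF that]])
      fix b assume "b \<in> a ` {1..Suc (Suc n)}"
      then obtain i where i: "1 \<le> i" "i \<le> Suc (Suc n)" "b = a i" by auto
      have "a i \<le> a (Suc (Suc n))"
        using a_less[of i "Suc (Suc n)"] i by (cases "i = Suc (Suc n)") auto
      then have "a i * (q * p ^ n) \<le> a (Suc (Suc n)) * (q * p ^ n)"
        using q_pos p_pos by (intro mult_right_mono) auto
      then show "0 < b \<and> b * (q * p ^ n) < 1 \<and> qbessel w b = 0"
        using not_large a_pos a_zero i by auto
    qed
    moreover have "inj_on a {1..Suc (Suc n)}"
      using a_less by (intro linorder_inj_onI') force
    ultimately show False by (simp add: card_image)
  qed
  have main: "\<bar>hahn_exton_J q \<nu> (q * j k)\<bar>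
      \<le> qprod (- p) * qprod (- w) / qprod p * q powr ((real k + \<nu>) * (real k - 1))"
    if k: "k \<ge> Suc (Suc (max N1 N2))" for k
  proof -
    obtain n where n: "k = Suc (Suc n)" "n \<ge> N1" "n \<ge> N2"
      using that[of "k - 2"] k by simp
    \<comment> \<open>The exponent \<open>M\<close> is chosen so that \<open>y = a k * p ^ M\<close> lies between \<open>q\<close> and \<open>1 / q\<close>.\<close>
    define M where "M = (LEAST m. a k * (q * p ^ m) < 1)"
    have "(\<lambda>m. a k * (q * p ^ m)) \<longlonglongrightarrow> a k * (q * 0)"
      by (intro tendsto_intros p_power_tendsto_0)
    then have "\<forall>\<^sub>F m in sequentially. a k * (q * p ^ m) < 1"
      by (intro order_tendstoD(2)) auto
    then obtain m0 where "a k * (q * p ^ m0) < 1"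
      unfolding eventually_sequentially by blast
    then have M: "a k * (q * p ^ M) < 1"
      unfolding M_def by (rule LeastI)
    have ak: "0 < a k" using a_pos n by simp
    have "n < M"
    proof (rule ccontr)
      assume "\<not> n < M"
      then have "a k * (q * p ^ n) \<le> a k * (q * p ^ M)"
        using ak q_pos p_pos p_less_1 by (intro mult_left_mono power_decreasing) auto
      then show False using large[OF n(2)] M n(1) by simp
    qed
    then obtain m where m: "M = Suc m" "n \<le> m" by (cases M) auto
    have m_large: "1 \<le> a k * (q * p ^ m)"
      using not_less_Least[of m "\<lambda>m. a k * (q * p ^ m) < 1"] m(1) by (simp add: M_def)
    define y where "y = a k * p ^ M"
    have "y = a k * (q * p ^ m) * q"
      by (simp add: y_def m p_eq power2_eq_square)
    then have y1: "q \<le> y"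
      using mult_right_mono[OF m_large, of q] q_pos by simp
    have y2: "y * q \<le> 1" using M by (simp add: y_def mult_ac)
    have ak_eq: "a k = y / p ^ Suc m" using p_pos by (simp add: y_def m)
    have y_bound: "y powr (\<nu> / 2) * \<bar>qbessel w (p * a k)\<bar>
        \<le> w ^ M * p ^ (M choose 2) * qprod (- p) * qprod (- w)"
      using bound[of m y] m n(3) y1 y2 a_zero[of k] n(1) unfolding ak_eq by simp
    have qj: "0 < q * j k" "(q * j k)\<^sup>2 = a k"
      using j_pos[of k] n q_pos by (simp_all add: a_def p_eq power_mult_distrib)
    have "(q * j k) powr \<nu> = ((q * j k) powr 2) powr (\<nu> / 2)"
      by (simp add: powr_powr)
    also have "(q * j k) powr 2 = a k"
      using qj by simp
    also have "a k powr (\<nu> / 2) = y powr (\<nu> / 2) / (p ^ M) powr (\<nu> / 2)"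
      using y1 q_pos p_pos by (simp add: ak_eq m powr_divide)
    also have "p ^ M = q powr (2 * real M)"
      using q_pos powr_realpow[of q "2 * M"] by (simp add: p_eq power_mult)
    also have "(q powr (2 * real M)) powr (\<nu> / 2) = q powr (real M * \<nu>)"
      by (simp add: powr_powr)
    finally have qj_powr: "(q * j k) powr \<nu> = y powr (\<nu> / 2) / q powr (real M * \<nu>)" .
    have "\<bar>hahn_exton_J q \<nu> (q * j k)\<bar> = (q * j k) powr \<nu> / qprod p * \<bar>qbessel w (p * a k)\<bar>"
      using hahn_exton_J_eq[OF w_def qj(1)] qprod_pos[OF p_less_1] by (simp add: qj(2) abs_mult)
    also have "\<dots> = (y powr (\<nu> / 2) * \<bar>qbessel w (p * a k)\<bar>) / (qprod p * q powr (real M * \<nu>))"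
      by (simp add: qj_powr)
    also have "\<dots> \<le> (w ^ M * p ^ (M choose 2) * qprod (- p) * qprod (- w)) / (qprod p * q powr (real M * \<nu>))"
      using y_bound qprod_pos[OF p_less_1] by (intro divide_right_mono) auto
    also have "\<dots> = qprod (- p) * qprod (- w) / qprod p * (w ^ M * p ^ (M choose 2) / q powr (real M * \<nu>))"
      by simp
    also have "w ^ M * p ^ (M choose 2) / q powr (real M * \<nu>) = q powr (real M * (real M + 1 + \<nu>))"
    proof -
      have "w ^ M = q powr (2 * (\<nu> + 1) * real M)"
        using q_pos by (simp add: w_def powr_powr flip: powr_realpow)
      moreover have "p ^ (M choose 2) = q powr (real M * (real M - 1))"
      proof -
        have "2 * (M choose 2) + M = M * M"
          by (induction M) (simp_all add: numeral_2_eq_2)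
        then have "real (2 * (M choose 2)) = real M * (real M - 1)"
          by (simp add: algebra_simps flip: of_nat_mult of_nat_add)
        then show ?thesis
          using powr_realpow[OF q_pos, of "2 * (M choose 2)"] by (simp add: p_eq power_mult)
      qed
      moreover have "2 * (\<nu> + 1) * real M + real M * (real M - 1) - real M * \<nu> = real M * (real M + 1 + \<nu>)"
        by (simp add: algebra_simps)
      ultimately show ?thesis by (simp flip: powr_add powr_diff)
    qed
    also have "q powr (real M * (real M + 1 + \<nu>)) \<le> q powr ((real k + \<nu>) * (real k - 1))"
    proof (rule powr_mono')
      have "(real k - 1) * (real k + \<nu>) \<le> real M * (real M + 1 + \<nu>)"
        using n m assms(3) by (intro mult_mono) auto
      then show "(real k + \<nu>) * (real k - 1) \<le> real M * (real M + 1 + \<nu>)"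
        by (simp add: mult.commute)
    qed (use q_pos q_less_1 in auto)
    finally show ?thesis
      using qprod_pos[of p] qprod_pos[of "- p"] qprod_pos[of "- w"] p_pos p_less_1 w_pos
      by (simp add: mult_left_mono divide_right_mono)
  qed
  show ?thesis
    unfolding p_def[symmetric] w_def[symmetric] qpoch_inf_eq_qprod eventually_sequentially
    using main by blast
qed

end
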